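(* Let $a\in\mathbb Z_{\ge0}$ and $m\in\mathbb N$, not both $a=0$ and $m=1$. Let $\mathcal P_{a+m\mathbb N}$ be the set of integer partitions all of whose parts lie in $\{a+mj : j\in\mathbb N\}$ (including the empty partition), and set $\zeta_{\mathcal P_{a+m\mathbb N}}(s):=\sum_{\lambda\in\mathcal P_{a+m\mathbb N}}n_\lambda^{-s}$, where $n_\lambda$ is the product of the parts of $\lambda$ ($n_\emptyset=1$). Then for every integer $n\ge2$, \[\zeta_{\mathcal P_{a+m\mathbb N}}(n)=\Gamma(1+a/m)^{-n}\prod_{r=0}^{n-1}\Gamma\!\left(1+\frac{a-e(r/n)}{m}\right),\] where $\Gamma$ is Euler's gamma function and $e(x):=e^{2\pi i x}$. *)

theory Defs
  imports "HOL-Analysis.Analysis" "HOL-Library.Multiset"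
begin

text \<open>
  An integer partition is the finite multiset of its parts, which are positive integers.
\<close>

definition partitions_into :: "nat set \<Rightarrow> nat multiset set" where
  "partitions_into S = {p. 0 \<notin># p \<and> set_mset p \<subseteq> S}"

text \<open>
  The index \<open>j\<close> ranges over the positive integers, so the smallest element is \<open>a + m\<close>.
\<close>

definition shifted_progression :: "nat \<Rightarrow> nat \<Rightarrow> nat set" where
  "shifted_progression a m = {a + m * j | j. j \<ge> 1}"

abbreviation partition_norm :: "nat multiset \<Rightarrow> nat" where
  "partition_norm \<equiv> prod_mset"

text \<open>
  The sum is unordered. As \<^const>\<open>infsum\<close> is 0 for families that are not summable,
  statements about values should also assert summability.
\<close>

definition partition_zeta_term :: "complex \<Rightarrow> nat multiset \<Rightarrow> complex" where
  "partition_zeta_term s p = of_nat (partition_norm p) powr (- s)"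

definition partition_zeta :: "nat multiset set \<Rightarrow> complex \<Rightarrow> complex" where
  "partition_zeta P s = infsum (partition_zeta_term s) P"

definition unit_exp :: "real \<Rightarrow> complex" where
  "unit_exp x = exp (2 * of_real pi * \<i> * of_real x)"

end

theory Submission
  imports Defs
begin

text \<open>
  The Euler product gives the sum over partitions with parts \<open>a + m * j\<close>, \<open>1 \<le> j \<le> N\<close>, as
  the product of the factors \<open>1 / (1 - (a + m * j) powr - n)\<close>. Factoring \<open>1 - x ^ n\<close> over the
  \<open>n\<close>-th roots of unity turns this into a product of ratios of Pochhammer symbols, and Gauss's
  limit for the Gamma function evaluates it as \<open>N\<close> tends to infinity; the powers of \<open>N\<close> cancel
  because the \<open>n\<close>-th roots of unity sum to 0.
\<close>

section \<open>Unordered sums over increasing unions\<close>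

lemma finite_subset_incseq_UnionE:
  assumes "finite X" "X \<subseteq> (\<Union>N. A N)" "incseq A"
  obtains N where "X \<subseteq> A N"
proof -
  have "\<exists>N. X \<subseteq> A N"
    using assms
  proof (induction X)
    case (insert x X)
    then obtain M N where "X \<subseteq> A M" "x \<in> A N" by auto
    then have "insert x X \<subseteq> A (max M N)"
      using incseqD[OF \<open>incseq A\<close>, of M "max M N"] incseqD[OF \<open>incseq A\<close>, of N "max M N"]
      by auto
    then show ?case ..
  qed simp
  with that show ?thesis by blast
qed

text \<open>Monotone convergence: a finite set of indices already lies in some \<open>A N\<close>,
  so its partial sum is at most \<open>L N \<le> l\<close>; conversely each \<open>L N\<close> is at
  most the total sum. Both bounds rest on the order, hence the restriction to real nonnegative
  terms.\<close>

lemma has_sum_incseq_Union: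
  fixes f :: "'a \<Rightarrow> real"
  assumes "incseq A" and nonneg: "\<And>x. x \<in> (\<Union>N. A N) \<Longrightarrow> f x \<ge> 0"
    and sums: "\<And>N. (f has_sum L N) (A N)" and lim: "L \<longlonglongrightarrow> l"
  shows "(f has_sum l) (\<Union>N. A N)"
proof -
  have "incseq L"
  proof (rule monoI)
    fix M N :: nat assume "M \<le> N"
    then have "A M \<subseteq> A N"
      by (rule incseqD[OF \<open>incseq A\<close>])
    then show "L M \<le> L N"
      by (rule has_sum_mono2[OF sums sums]) (use nonneg in auto)
  qed
  then have L_le: "L N \<le> l" for N
    using lim by (rule incseq_le)
  have bound: "sum f X \<le> l" if X: "finite X" "X \<subseteq> (\<Union>N. A N)" for X
  proof -
    obtain N where "X \<subseteq> A N"
      using X \<open>incseq A\<close> by (rule finite_subset_incseq_UnionE)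
    then have "sum f X \<le> L N"
      using finite_sum_le_has_sum[OF sums X(1)] nonneg by blast
    then show ?thesis
      using L_le order_trans by blast
  qed
  have "f summable_on (\<Union>N. A N)"
    by (intro nonneg_bounded_partial_sums_imp_summable_on[where C = l]
        eventually_finite_subsets_at_top_weakI) (use nonneg bound in auto)
  then have sum: "(f has_sum infsum f (\<Union>N. A N)) (\<Union>N. A N)"
    by simp
  have "infsum f (\<Union>N. A N) \<le> l"
    using has_sum_le_finite_sums[OF sum] bound by blast
  moreover have "l \<le> infsum f (\<Union>N. A N)"
  proof (rule LIMSEQ_le_const2[OF lim], intro exI allI impI)
    fix N show "L N \<le> infsum f (\<Union>N. A N)"
      by (rule has_sum_mono2[OF sums sum]) (use nonneg in auto)
  qed
  ultimately show ?thesis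
    using sum by (metis order_antisym)
qed

section \<open>The Euler product for partitions\<close>

lemma partitions_into_empty [simp]: "partitions_into {} = {{#}}"
  by (auto simp: partitions_into_def)

text \<open>A partition has only finitely many distinct parts, so they all appear at some finite
  stage. This is how Euler products over finite sets of parts reach the infinite
  progression.\<close>

lemma partitions_into_Union_incseq:
  assumes "incseq S"
  shows "partitions_into (\<Union>N. S N) = (\<Union>N. partitions_into (S N))"
proof (intro equalityI subsetI)
  fix p assume p: "p \<in> partitions_into (\<Union>N. S N)"
  then have "set_mset p \<subseteq> (\<Union>N. S N)"
    by (simp add: partitions_into_def)
  with finite_set_mset obtain N where "set_mset p \<subseteq> S N"
    using \<open>incseq S\<close> by (rule finite_subset_incseq_UnionE)
  with p show "p \<in> (\<Union>N. partitions_into (S N))"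
    by (auto simp: partitions_into_def)
qed (auto simp: partitions_into_def)

text \<open>A partition with parts in \<open>insert k S\<close> amounts to its parts other than
  \<open>k\<close> together with the multiplicity of \<open>k\<close>. Summing over the multiplicity
  is a geometric series with ratio \<open>f k\<close>, which contributes the new Euler
  factor.\<close>

lemma has_sum_insert_partitions_into:
  fixes f :: "nat \<Rightarrow> real"
  assumes k: "k \<notin> S" "k \<noteq> 0" "0 \<le> f k" "f k < 1" and nonneg: "\<And>x. x \<in> S \<Longrightarrow> f x \<ge> 0"
    and sums: "((\<lambda>p. \<Prod>x\<in>#p. f x) has_sum L) (partitions_into S)"
  shows "((\<lambda>p. \<Prod>x\<in>#p. f x) has_sum (L / (1 - f k))) (partitions_into (insert k S))"
proof -
  let ?F = "\<lambda>p. \<Prod>x\<in>#p. f x"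
  have F_nonneg: "?F p \<ge> 0" if "p \<in> partitions_into S" for p
    using that nonneg by (induction p) (auto simp: partitions_into_def)
  have geo: "((\<lambda>i. f k ^ i) has_sum (1 / (1 - f k))) UNIV"
    by (rule sums_nonneg_imp_has_sum) (use k in \<open>auto intro: geometric_sums\<close>)
  have inner: "((\<lambda>i. case (p, i) of (p, i) \<Rightarrow> ?F p * f k ^ i) has_sum (?F p / (1 - f k))) UNIV" for p
    using has_sum_cmult_right[OF geo, of "?F p"] by simp
  have outer: "((\<lambda>p. ?F p / (1 - f k)) has_sum (L / (1 - f k))) (partitions_into S)"
    using sums by (rule has_sum_divide_const)
  \<comment> \<open>Iterated sums give the sum over the product set only under joint summability,
    which follows here from nonnegativity.\<close>
  have "((\<lambda>(p, i). ?F p * f k ^ i) has_sum (L / (1 - f k))) (partitions_into S \<times> (UNIV :: nat set))"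
    by (intro has_sum_SigmaI[OF inner outer] summable_on_SigmaI[OF inner]
        has_sum_imp_summable[OF outer]) (use F_nonneg k in auto)
  also have "?this \<longleftrightarrow> ?thesis"
  proof (rule has_sum_reindex_bij_witness[of _ "\<lambda>p. (filter_mset (\<lambda>x. x \<noteq> k) p, count p k)"
        "\<lambda>(p, i). p + replicate_mset i k"])
    fix q assume "q \<in> partitions_into S \<times> (UNIV :: nat set)"
    then obtain p i where q: "q = (p, i)" "p \<in> partitions_into S" by auto
    \<comment> \<open>As \<open>k\<close> is not in \<open>S\<close>, removing and counting the
      copies of \<open>k\<close> recovers exactly the pair \<open>(p, i)\<close>.\<close>
    then have "k \<notin># p" using k by (auto simp: partitions_into_def)
    then have "filter_mset (\<lambda>x. x \<noteq> k) p = p" "count p k = 0"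
      by (auto simp: filter_mset_eq_conv count_eq_zero_iff)
    then show "(filter_mset (\<lambda>x. x \<noteq> k) (case q of (p, i) \<Rightarrow> p + replicate_mset i k),
        count (case q of (p, i) \<Rightarrow> p + replicate_mset i k) k) = q"
      by (auto simp: q)
    show "(case q of (p, i) \<Rightarrow> p + replicate_mset i k) \<in> partitions_into (insert k S)"
      using q k by (auto simp: partitions_into_def split: if_splits)
    show "?F (case q of (p, i) \<Rightarrow> p + replicate_mset i k) = (case q of (p, i) \<Rightarrow> ?F p * f k ^ i)"
      by (simp add: q)
  next
    fix p assume "p \<in> partitions_into (insert k S)"
    then show "(filter_mset (\<lambda>x. x \<noteq> k) p, count p k) \<in> partitions_into S \<times> UNIV"
      by (auto simp: partitions_into_def)
    show "(case (filter_mset (\<lambda>x. x \<noteq> k) p, count p k) of (p, i) \<Rightarrow> p + replicate_mset i k) = p"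
      by (auto simp: multiset_eq_iff)
  qed simp
  finally show ?thesis .
qed

lemma partition_euler_product:
  fixes f :: "nat \<Rightarrow> real"
  assumes "finite S" "0 \<notin> S" "\<And>k. k \<in> S \<Longrightarrow> 0 \<le> f k \<and> f k < 1"
  shows "((\<lambda>p. \<Prod>x\<in>#p. f x) has_sum (\<Prod>k\<in>S. 1 / (1 - f k))) (partitions_into S)"
  using assms
proof (induction S)
  case empty
  then show ?case by (simp add: has_sum_finite_iff)
next
  case (insert k S)
  then have "((\<lambda>p. \<Prod>x\<in>#p. f x) has_sum ((\<Prod>k\<in>S. 1 / (1 - f k)) / (1 - f k)))
      (partitions_into (insert k S))"
    by (intro has_sum_insert_partitions_into) auto
  with insert.hyps show ?case by simp
qed

section \<open>Roots of unity and limits of Pochhammer ratios\<close>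

lemma unit_exp_eq_cis: "unit_exp (real r / real n) = cis (2 * pi * real r / real n)"
  by (simp add: unit_exp_def cis_conv_exp mult_ac)

lemma sum_unit_exp:
  assumes "n > 1"
  shows "(\<Sum>r<n. unit_exp (real r / real n)) = 0"
  using sum.reindex_bij_betw[OF Complex.bij_betw_roots_unity[of n], of "\<lambda>z. z"]
    sum_roots_unity[OF assms] assms
  by (simp add: unit_exp_eq_cis)

text \<open>Both sides are polynomials in \<open>x\<close> of degree at most \<open>n\<close> with
  the same coefficient at \<open>n\<close>, and both vanish at the \<open>n\<close> roots of unity,
  so they coincide.\<close>

lemma power_minus_one_eq_prod_unit_exp:
  assumes "n > 0"
  shows "x ^ n - 1 = (\<Prod>r<n. x - unit_exp (real r / real n))"
proof -
  let ?R = "{z :: complex. z ^ n = 1}"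
  have fin: "finite ?R" and card: "card ?R = n"
    using assms by (auto simp: finite_roots_unity card_roots_unity_eq)
  have "monom 1 n - 1 = (\<Prod>z\<in>?R. [:- z, 1:])"
  proof (rule poly_eqI_degree_lead_coeff[where n = n and A = ?R])
    have "degree (\<Prod>z\<in>?R. [:- z, 1:]) = n"
      by (subst degree_prod_eq_sum_degree) (auto simp: card)
    moreover from this have "coeff (\<Prod>z\<in>?R. [:- z, 1:]) n = 1"
      using lead_coeff_prod[of "\<lambda>z. [:- z, 1:]" ?R] by simp
    ultimately show "degree (\<Prod>z\<in>?R. [:- z, 1:]) \<le> n"
      "coeff (monom 1 n - 1) n = coeff (\<Prod>z\<in>?R. [:- z, 1:]) n"
      using assms by auto
    show "degree (monom 1 n - 1 :: complex poly) \<le> n"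
      by (intro degree_diff_le) (auto simp: degree_monom_le)
  qed (use fin card in \<open>auto simp: poly_prod poly_monom\<close>)
  then have "x ^ n - 1 = (\<Prod>z\<in>?R. x - z)"
    by (auto simp: poly_eq_poly_eq_iff[symmetric] fun_eq_iff poly_prod poly_monom)
  also have "\<dots> = (\<Prod>r<n. x - unit_exp (real r / real n))"
    using prod.reindex_bij_betw[OF Complex.bij_betw_roots_unity[OF assms], of "\<lambda>z. x - z"]
    by (simp add: unit_exp_eq_cis)
  finally show ?thesis .
qed

text \<open>In a quotient of two terms of \<open>Gamma_series\<close> the factorials cancel, leaving
  the Pochhammer ratio times \<open>N\<close> to the power \<open>w i - z i\<close>. Equality of the
  two sums makes these powers multiply to 1.\<close>

lemma prod_pochhammer_ratio_LIMSEQ: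
  fixes z w :: "'i \<Rightarrow> complex"
  assumes sum_eq: "(\<Sum>i\<in>I. z i) = (\<Sum>i\<in>I. w i)" and z: "\<And>i. i \<in> I \<Longrightarrow> z i \<notin> \<int>\<^sub>\<le>\<^sub>0"
  shows "(\<lambda>N. \<Prod>i\<in>I. pochhammer (z i) (Suc N) / pochhammer (w i) (Suc N))
    \<longlonglongrightarrow> (\<Prod>i\<in>I. Gamma (w i) / Gamma (z i))"
proof -
  have "(\<lambda>N. \<Prod>i\<in>I. Gamma_series (w i) N / Gamma_series (z i) N)
      \<longlonglongrightarrow> (\<Prod>i\<in>I. Gamma (w i) / Gamma (z i))"
    \<comment> \<open>\<open>Gamma\<close> is 0 at its poles by convention, so the denominators
      \<open>Gamma (z i)\<close> are nonzero exactly because each \<open>z i\<close> avoids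
      them.\<close>
    by (intro tendsto_prod tendsto_divide Gamma_series_LIMSEQ) (use z in \<open>auto simp: Gamma_eq_zero_iff\<close>)
  moreover have "(\<Prod>i\<in>I. Gamma_series (w i) N / Gamma_series (z i) N)
      = (\<Prod>i\<in>I. pochhammer (z i) (Suc N) / pochhammer (w i) (Suc N))" for N
  proof (cases "finite I")
    case True
    have "Gamma_series (w i) N / Gamma_series (z i) N
        = exp ((w i - z i) * of_real (ln (real N))) *
          (pochhammer (z i) (Suc N) / pochhammer (w i) (Suc N))" for i
      by (simp add: Gamma_series_def exp_diff ring_distribs)
    moreover have "(\<Prod>i\<in>I. exp ((w i - z i) * of_real (ln (real N)))) = 1"
      using True sum_eq by (simp flip: exp_sum sum_distrib_right add: sum_subtractf)
    ultimately show ?thesis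
      by (simp only: prod.distrib) simp
  qed simp
  ultimately show ?thesis by simp
qed

section \<open>Zeta terms and finite Euler products over the progression\<close>

text \<open>Exposes the complex term as a real product over the parts, the form required by the
  Euler product and by monotone convergence.\<close>

lemma partition_zeta_term_of_nat:
  assumes "0 \<notin># p"
  shows "partition_zeta_term (of_nat n) p = of_real (\<Prod>x\<in>#p. 1 / real x ^ n)"
proof -
  have "prod_mset p > 0"
    using assms by (simp add: prod_mset_zero_iff flip: neq0_conv)
  then have "partition_zeta_term (of_nat n) p = 1 / of_nat (prod_mset p) ^ n"
    using assms by (simp add: partition_zeta_term_def powr_minus powr_nat divide_simps)
  also have "\<dots> = of_real (\<Prod>x\<in>#p. 1 / real x ^ n)"
    by (induction p) (simp_all add: power_mult_distrib flip: divide_divide_eq_left')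
  finally show ?thesis .
qed

lemma one_minus_inverse_power_eq_prod:
  fixes x :: complex  \<comment> \<open>for \<open>x ^ n = 1\<close> both sides are 0, by division by 0\<close>
  assumes "n > 0" "x \<noteq> 0" "m \<noteq> 0"
  shows "1 / (1 - 1 / x ^ n) = (\<Prod>r<n. (x / m) / ((x - unit_exp (real r / real n)) / m))"
proof -
  have "(\<Prod>r<n. (x / m) / ((x - unit_exp (real r / real n)) / m))
      = (\<Prod>r<n. x / (x - unit_exp (real r / real n)))"
    using assms by simp
  also have "\<dots> = x ^ n / (x ^ n - 1)"
    using assms by (simp add: prod_dividef power_minus_one_eq_prod_unit_exp)
  also have "\<dots> = 1 / (1 - 1 / x ^ n)"
    using assms by (simp add: divide_simps)
  finally show ?thesis ..
qed

text \<open>Dividing by \<open>m\<close> turns steps of length \<open>m\<close> into steps of length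
  1, so after swapping the products each root of unity yields a ratio of rising factorials. Counting
  from \<open>Suc j\<close> gives the base point its summand 1.\<close>

lemma prod_progression_eq_pochhammer_ratio:
  fixes a m n N :: nat
  assumes "m > 0" "n > 0"
  shows "(\<Prod>j\<le>N. 1 / (1 - 1 / of_nat (a + m * Suc j) ^ n :: complex)) =
    (\<Prod>r<n. pochhammer (1 + of_nat a / of_nat m) (Suc N)
      / pochhammer (1 + (of_nat a - unit_exp (real r / real n)) / of_nat m) (Suc N))"
proof -
  have "(\<Prod>j\<le>N. 1 / (1 - 1 / of_nat (a + m * Suc j) ^ n :: complex)) =
      (\<Prod>j\<le>N. \<Prod>r<n. (of_nat (a + m * Suc j) / of_nat m)
        / ((of_nat (a + m * Suc j) - unit_exp (real r / real n)) / of_nat m))"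
    by (intro prod.cong refl one_minus_inverse_power_eq_prod)
      (use assms in \<open>auto simp del: of_nat_add of_nat_mult\<close>)
  also have "\<dots> = (\<Prod>j\<le>N. \<Prod>r<n. ((1 + of_nat a / of_nat m) + of_nat j)
        / ((1 + (of_nat a - unit_exp (real r / real n)) / of_nat m) + of_nat j))"
    using assms by (intro prod.cong refl arg_cong2[of _ _ _ _ "(/)"]) (simp_all add: field_simps)
  also have "\<dots> = (\<Prod>r<n. pochhammer (1 + of_nat a / of_nat m) (Suc N)
      / pochhammer (1 + (of_nat a - unit_exp (real r / real n)) / of_nat m) (Suc N))"
    by (subst prod.swap) (simp add: prod_dividef pochhammer_prod atLeast0LessThan lessThan_Suc_atMost)
  finally show ?thesis .
qed

theorem theorem5p1:
  fixes a m n :: nat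
  assumes "m \<ge> 1" and "\<not> (a = 0 \<and> m = 1)" and "n \<ge> 2"
  shows "partition_zeta_term (of_nat n) summable_on partitions_into (shifted_progression a m)
    \<and> partition_zeta (partitions_into (shifted_progression a m)) (of_nat n)
      = inverse (Gamma (1 + of_nat a / of_nat m :: complex) ^ n)
        * (\<Prod>r = 0..n - 1. Gamma (1 + (of_nat a - unit_exp (real r / real n)) / of_nat m))"
proof -
  define f :: "nat \<Rightarrow> real" where "f k = 1 / real k ^ n" for k
  \<comment> \<open>\<open>S N\<close> has \<open>N + 1\<close> elements, matching the
    \<open>Suc N\<close> factors of the Pochhammer symbols in \<open>Gamma_series\<close>.\<close>
  define S where "S N = (\<lambda>j. a + m * Suc j) ` {..N}" for N :: nat
  define L where "L N = (\<Prod>k\<in>S N. 1 / (1 - f k))" for N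
  define z :: complex where "z = 1 + of_nat a / of_nat m"
  define w where "w r = 1 + (of_nat a - unit_exp (real r / real n)) / of_nat m" for r
  define G where "G = (\<Prod>r<n. Gamma (w r) / Gamma z)"
  \<comment> \<open>Excluding \<open>a = 0\<close>, \<open>m = 1\<close> keeps 1 from being a part;
    with it the geometric series for that part would diverge.\<close>
  have part: "k > 1" if k: "k \<in> S N" for k N
  proof -
    obtain j where "k = a + m * Suc j"
      using k unfolding S_def by blast
    moreover have "a + m > 1"
      using assms by linarith
    ultimately show ?thesis by (simp add: trans_less_add1)
  qed
  have "incseq S"
    unfolding S_def by (intro monoI image_mono) auto
  have "(\<Union>N. S N) = shifted_progression a m"
  proof (intro equalityI subsetI)
    fix k assume "k \<in> shifted_progression a m"
    then obtain j where "k = a + m * j" "j \<ge> 1"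
      unfolding shifted_progression_def by blast
    then have "k = a + m * Suc (j - 1)" by simp
    then have "k \<in> S (j - 1)"
      unfolding S_def by blast
    then show "k \<in> (\<Union>N. S N)" by blast
  next
    fix k assume "k \<in> (\<Union>N. S N)"
    then obtain j where "k = a + m * Suc j"
      unfolding S_def by blast
    moreover have "Suc j \<ge> 1" by simp
    ultimately show "k \<in> shifted_progression a m"
      unfolding shifted_progression_def by blast
  qed
  with partitions_into_Union_incseq[OF \<open>incseq S\<close>]
  have U: "partitions_into (shifted_progression a m) = (\<Union>N. partitions_into (S N))"
    by simp
  have f: "0 \<le> f k \<and> f k < 1" if "k \<in> S N" for k N
    using part[OF that] assms by (simp add: f_def)
  have sums: "((\<lambda>p. \<Prod>x\<in>#p. f x) has_sum L N) (partitions_into (S N))" for N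
    unfolding L_def
  proof (rule partition_euler_product)
    show "finite (S N)" by (simp add: S_def)
    show "0 \<notin> S N" using part[of 0 N] by auto
  qed (rule f)
  have L_eq: "complex_of_real (L N) = (\<Prod>r<n. pochhammer z (Suc N) / pochhammer (w r) (Suc N))" for N
  proof -
    have "inj_on (\<lambda>j. a + m * Suc j) {..N}"
      using assms by (auto simp: inj_on_def)
    then have "complex_of_real (L N) = (\<Prod>j\<le>N. 1 / (1 - 1 / of_nat (a + m * Suc j) ^ n))"
      unfolding L_def S_def f_def
      by (simp only: prod.reindex o_def) simp
    then show ?thesis
      using prod_progression_eq_pochhammer_ratio[of m n a N] assms by (simp add: z_def w_def)
  qed
  have z_pos: "z \<notin> \<int>\<^sub>\<le>\<^sub>0"
  proof -
    have "z = of_real (1 + real a / real m)" by (simp add: z_def)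
    moreover have "\<not> 1 + real a / real m \<le> 0"
      by (simp add: not_le add_pos_nonneg)
    ultimately show ?thesis
      using nonpos_Ints_nonpos by (auto simp only: of_real_in_nonpos_Ints_iff)
  qed
  have lim: "(\<lambda>N. complex_of_real (L N)) \<longlonglongrightarrow> G"
    unfolding L_eq G_def
  proof (rule prod_pochhammer_ratio_LIMSEQ)
    \<comment> \<open>The balance condition for the Gamma limit reduces to the vanishing sum of the
      \<open>n\<close>-th roots of unity, which requires \<open>n > 1\<close>.\<close>
    have "(\<Sum>r<n. z - w r) = (\<Sum>r<n. unit_exp (real r / real n)) / of_nat m"
      by (simp add: z_def w_def sum_divide_distrib diff_divide_distrib)
    with sum_unit_exp[of n] assms show "(\<Sum>r<n. z) = (\<Sum>r<n. w r)"
      by (simp add: sum_subtractf)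
  qed (use z_pos in auto)
  \<comment> \<open>The finite products are real, so their limit \<open>G\<close> is real too.
    Monotone convergence is applied to \<open>Re G\<close>, and the result is then carried back to
    the complex numbers.\<close>
  then have limRe: "L \<longlonglongrightarrow> Re G"
    using tendsto_Re[of "\<lambda>N. complex_of_real (L N)"] by simp
  have G_real: "complex_of_real (Re G) = G"
    using LIMSEQ_unique[OF tendsto_of_real[OF limRe] lim] .
  have "((\<lambda>p. \<Prod>x\<in>#p. f x) has_sum Re G) (partitions_into (shifted_progression a m))"
    unfolding U
  proof (rule has_sum_incseq_Union[OF _ _ sums limRe])
    show "incseq (\<lambda>N. partitions_into (S N))"
      using \<open>incseq S\<close> by (auto simp: incseq_def partitions_into_def dest: subsetD)
    show "(\<Prod>x\<in>#p. f x) \<ge> 0" for p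
      by (induction p) (auto simp: f_def)
  qed
  from has_sum_of_real[where 'a = complex, OF this]
  have "((\<lambda>p. complex_of_real (\<Prod>x\<in>#p. f x)) has_sum G)
      (partitions_into (shifted_progression a m))"
    by (simp only: G_real)
  then have "(partition_zeta_term (of_nat n) has_sum G) (partitions_into (shifted_progression a m))"
    by (rule has_sum_cong[THEN iffD1, rotated])
      (simp add: partition_zeta_term_of_nat f_def partitions_into_def)
  moreover have "G = inverse (Gamma z ^ n) * (\<Prod>r = 0..n - 1. Gamma (w r))"
  proof -
    have "{..<n} = {0..n - 1}"
      using assms by auto
    then show ?thesis
      using assms by (simp add: G_def prod_dividef divide_simps)
  qed
  \<comment> \<open>\<open>has_sum\<close> contains both conjuncts: summability and the value of the
    sum.\<close>
  ultimately show ?thesis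
    by (simp add: partition_zeta_def has_sum_iff z_def w_def)
qed

end
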